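(* There exists a bounded group $G\leqslant\mathrm{GL}(c_0)$ of isomorphisms of the real Banach space $c_0$ which is infinite, not light, SOT-discrete, and does not admit a distinguished point.
   Context: $\mathrm{GL}(X)$ is the group of bounded linear isomorphisms of $X$ onto itself; a subgroup is bounded if it is bounded in operator norm. The Strong Operator Topology (SOT) is the topology of pointwise norm convergence on $X$; the Weak Operator Topology (WOT) is generated by the maps $T\mapsto x^*(Tx)$, $x\in X$, $x^*\in X^*$. $G$ is light if the WOT and the SOT coincide on $G$, and SOT-discrete if it is discrete in the SOT. A point $x\in X$ is distinguished for $G$ if $\inf_{T\in G,\,T\neq \mathrm{Id}}\|Tx-x\|>0$. *)

theory Defs
  imports "HOL-Analysis.Analysis" "HOL-Algebra.Group"
begin

typedef c0 = "{x :: nat \<Rightarrow> real. x \<longlonglongrightarrow> 0}"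
  morphisms c0_nth Abs_c0
  by (rule exI[of _ "\<lambda>_. 0"]) simp

setup_lifting type_definition_c0

lemma c0_nth_tendsto: "c0_nth x \<longlonglongrightarrow> 0"
  using c0_nth[of x] by simp

lemma c0_eqI: "(\<And>n. c0_nth x n = c0_nth y n) \<Longrightarrow> x = y"
  by transfer auto

instantiation c0 :: real_vector
begin

lift_definition zero_c0 :: c0 is "\<lambda>_. 0" by simp

lift_definition plus_c0 :: "c0 \<Rightarrow> c0 \<Rightarrow> c0" is "\<lambda>x y n. x n + y n"
  using tendsto_add by fastforce

lift_definition minus_c0 :: "c0 \<Rightarrow> c0 \<Rightarrow> c0" is "\<lambda>x y n. x n - y n"
  using tendsto_diff by fastforce

lift_definition uminus_c0 :: "c0 \<Rightarrow> c0" is "\<lambda>x n. - x n"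
  using tendsto_minus by fastforce

lift_definition scaleR_c0 :: "real \<Rightarrow> c0 \<Rightarrow> c0" is "\<lambda>r x n. r * x n"
  using tendsto_mult_right_zero by blast

instance
  by standard (transfer; auto simp: algebra_simps)+

end

lemmas c0_nth_simps [simp] =
  zero_c0.rep_eq plus_c0.rep_eq minus_c0.rep_eq uminus_c0.rep_eq scaleR_c0.rep_eq

instantiation c0 :: real_normed_vector
begin

definition norm_c0 :: "c0 \<Rightarrow> real" where
  "norm x = (SUP n. \<bar>c0_nth x n\<bar>)"

lemma bdd_above_c0_nth: "bdd_above (range (\<lambda>n. \<bar>c0_nth x n\<bar>))"
proof -
  have "Bseq (c0_nth x)"
    using c0_nth_tendsto convergentI convergent_imp_Bseq by blast
  then obtain K where "\<forall>n. norm (c0_nth x n) \<le> K"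
    unfolding Bseq_def by blast
  then show ?thesis
    by (intro bdd_aboveI[of _ K]) auto
qed

lemma abs_c0_nth_le_norm: "\<bar>c0_nth x n\<bar> \<le> norm x"
  unfolding norm_c0_def by (rule cSUP_upper[OF _ bdd_above_c0_nth]) simp

lemma norm_c0_leI: "(\<And>n. \<bar>c0_nth x n\<bar> \<le> B) \<Longrightarrow> norm x \<le> B"
  unfolding norm_c0_def by (rule cSUP_least) auto

definition dist_c0 :: "c0 \<Rightarrow> c0 \<Rightarrow> real" where
  "dist_c0 x y = norm (x - y)"

definition sgn_c0 :: "c0 \<Rightarrow> c0" where
  "sgn_c0 x = x /\<^sub>R norm x"

definition uniformity_c0 :: "(c0 \<times> c0) filter" where
  "uniformity_c0 = (INF e\<in>{0<..}. principal {(x, y). dist x y < e})"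

definition open_c0 :: "c0 set \<Rightarrow> bool" where
  "open_c0 S = (\<forall>x\<in>S. \<forall>\<^sub>F (x', y) in uniformity. x' = x \<longrightarrow> y \<in> S)"

instance
proof
  fix x y :: c0 and a :: real
  show "norm x = 0 \<longleftrightarrow> x = 0"
  proof
    assume "norm x = 0"
    then show "x = 0"
      using abs_c0_nth_le_norm[of x] by (intro c0_eqI) auto
  qed (simp add: norm_c0_def)
  show "norm (x + y) \<le> norm x + norm y"
  proof (rule norm_c0_leI)
    fix n
    show "\<bar>c0_nth (x + y) n\<bar> \<le> norm x + norm y"
      using abs_c0_nth_le_norm[of x n] abs_c0_nth_le_norm[of y n] by simp
  qed
  have le: "norm (b *\<^sub>R z) \<le> \<bar>b\<bar> * norm z" for b and z :: c0
    by (rule norm_c0_leI) (simp add: abs_mult abs_c0_nth_le_norm mult_left_mono)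
  show "norm (a *\<^sub>R x) = \<bar>a\<bar> * norm x"
  proof (cases "a = 0")
    case True
    then show ?thesis by (simp add: norm_c0_def)
  next
    case False
    have "\<bar>a\<bar> * norm x = \<bar>a\<bar> * norm (inverse a *\<^sub>R (a *\<^sub>R x))"
      using False by simp
    also have "\<dots> \<le> \<bar>a\<bar> * (\<bar>inverse a\<bar> * norm (a *\<^sub>R x))"
      by (intro mult_left_mono le) simp
    also have "\<dots> = norm (a *\<^sub>R x)"
      using False by (simp add: field_simps)
    finally show ?thesis
      using le[of a x] by simp
  qed
qed (simp_all add: dist_c0_def sgn_c0_def uniformity_c0_def open_c0_def)

end

instance c0 :: banach
proof
  fix X :: "nat \<Rightarrow> c0"
  assume C: "Cauchy X"
  have le: "\<bar>c0_nth (X m) k - c0_nth (X n) k\<bar> \<le> dist (X m) (X n)" for m n k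
    using abs_c0_nth_le_norm[of "X m - X n" k] by (simp add: dist_norm)
  have "Cauchy (\<lambda>n. c0_nth (X n) k)" for k
    unfolding Cauchy_def
  proof (intro allI impI)
    fix e :: real
    assume "e > 0"
    with C obtain M where M: "\<forall>m\<ge>M. \<forall>n\<ge>M. dist (X m) (X n) < e"
      unfolding Cauchy_def by blast
    have "dist (c0_nth (X m) k) (c0_nth (X n) k) < e" if "m \<ge> M" "n \<ge> M" for m n
      using le[of m k n] M that by (force simp: dist_real_def)
    then show "\<exists>M. \<forall>m\<ge>M. \<forall>n\<ge>M. dist (c0_nth (X m) k) (c0_nth (X n) k) < e"
      by blast
  qed
  then have "\<forall>k. \<exists>l. (\<lambda>n. c0_nth (X n) k) \<longlonglongrightarrow> l"
    using Cauchy_convergent convergent_def by blast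
  then obtain l where l: "\<And>k. (\<lambda>n. c0_nth (X n) k) \<longlonglongrightarrow> l k"
    by metis
  have ex: "\<exists>M. \<forall>m\<ge>M. \<forall>k. \<bar>c0_nth (X m) k - l k\<bar> \<le> e" if e: "e > 0" for e
  proof -
    obtain M where M: "\<forall>m\<ge>M. \<forall>n\<ge>M. dist (X m) (X n) < e"
      using C e unfolding Cauchy_def by blast
    have "\<bar>c0_nth (X m) k - l k\<bar> \<le> e" if m: "m \<ge> M" for m k
    proof (rule LIMSEQ_le_const2)
      show "(\<lambda>n. \<bar>c0_nth (X m) k - c0_nth (X n) k\<bar>) \<longlonglongrightarrow> \<bar>c0_nth (X m) k - l k\<bar>"
        by (intro tendsto_intros l)
      show "\<exists>N. \<forall>n\<ge>N. \<bar>c0_nth (X m) k - c0_nth (X n) k\<bar> \<le> e"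
        using le[of m k] M m by (meson less_imp_le order_trans)
    qed
    then show ?thesis by blast
  qed
  have l0: "l \<longlonglongrightarrow> 0"
  proof (rule LIMSEQ_I)
    fix r :: real
    assume r: "0 < r"
    then obtain M where M: "\<forall>k. \<bar>c0_nth (X M) k - l k\<bar> \<le> r / 2"
      using ex[of "r / 2"] by auto
    obtain N where N: "\<forall>k\<ge>N. \<bar>c0_nth (X M) k\<bar> < r / 2"
      using LIMSEQ_D[OF c0_nth_tendsto[of "X M"], of "r / 2"] r by auto
    have "norm (l k - 0) < r" if "k \<ge> N" for k
    proof -
      have "\<bar>c0_nth (X M) k - l k\<bar> \<le> r / 2" "\<bar>c0_nth (X M) k\<bar> < r / 2"
        using M N that by auto
      then show ?thesis unfolding real_norm_def by linarith
    qed
    then show "\<exists>N. \<forall>k\<ge>N. norm (l k - 0) < r" by blast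
  qed
  have L: "c0_nth (Abs_c0 l) = l"
    using l0 by (simp add: Abs_c0_inverse)
  have "X \<longlonglongrightarrow> Abs_c0 l"
  proof (rule LIMSEQ_I)
    fix r :: real
    assume r: "0 < r"
    then obtain M where M: "\<forall>m\<ge>M. \<forall>k. \<bar>c0_nth (X m) k - l k\<bar> \<le> r / 2"
      using ex[of "r / 2"] by auto
    have "norm (X m - Abs_c0 l) \<le> r / 2" if "m \<ge> M" for m
      using M that by (intro norm_c0_leI) (simp add: L)
    then show "\<exists>M. \<forall>m\<ge>M. norm (X m - Abs_c0 l) < r"
      using r by (metis field_sum_of_halves less_add_same_cancel1 half_gt_zero order_le_less_trans)
  qed
  then show "convergent X"
    by (rule convergentI)
qed

definition GL :: "('a::real_normed_vector \<Rightarrow>\<^sub>L 'a) monoid" where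
  "GL = \<lparr>carrier = {T. bij (blinfun_apply T) \<and> bounded_linear (inv_into UNIV (blinfun_apply T))},
         mult = (o\<^sub>L), one = id_blinfun\<rparr>"

lemma group_GL: "group (GL :: ('a::real_normed_vector \<Rightarrow>\<^sub>L 'a) monoid)"
proof (rule groupI)
  let ?G = "GL :: ('a \<Rightarrow>\<^sub>L 'a) monoid"
  fix S T :: "'a \<Rightarrow>\<^sub>L 'a"
  assume S: "S \<in> carrier ?G" and T: "T \<in> carrier ?G"
  have "inv_into UNIV (blinfun_apply S \<circ> blinfun_apply T)
      = inv_into UNIV (blinfun_apply T) \<circ> inv_into UNIV (blinfun_apply S)"
    using S T by (intro o_inv_distrib) (auto simp: GL_def)
  moreover have "bounded_linear (inv_into UNIV (blinfun_apply T) \<circ> inv_into UNIV (blinfun_apply S))"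
    using S T unfolding o_def GL_def by (auto intro: bounded_linear_compose)
  moreover have "bij (blinfun_apply S \<circ> blinfun_apply T)"
    using S T by (auto simp: GL_def intro: bij_comp)
  ultimately show "S \<otimes>\<^bsub>?G\<^esub> T \<in> carrier ?G"
    by (simp add: GL_def blinfun_compose.rep_eq)
next
  show "\<one>\<^bsub>GL\<^esub> \<in> carrier (GL :: ('a \<Rightarrow>\<^sub>L 'a) monoid)"
  proof -
    have "blinfun_apply (id_blinfun :: 'a \<Rightarrow>\<^sub>L 'a) = id"
      by (simp add: fun_eq_iff)
    then show ?thesis
      by (simp add: GL_def inv_id bounded_linear_ident id_def[symmetric])
        (simp add: id_def bounded_linear_ident)
  qed
next
  let ?G = "GL :: ('a \<Rightarrow>\<^sub>L 'a) monoid"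
  fix T :: "'a \<Rightarrow>\<^sub>L 'a"
  assume T: "T \<in> carrier ?G"
  let ?S = "Blinfun (inv_into UNIV (blinfun_apply T))"
  have b: "bij (blinfun_apply T)" and l: "bounded_linear (inv_into UNIV (blinfun_apply T))"
    using T by (auto simp: GL_def)
  have S: "blinfun_apply ?S = inv_into UNIV (blinfun_apply T)"
    using l by (rule bounded_linear_Blinfun_apply)
  have "?S \<in> carrier ?G"
    using b by (simp add: GL_def S bij_imp_bij_inv inv_inv_eq blinfun.bounded_linear_right)
  moreover have "?S \<otimes>\<^bsub>?G\<^esub> T = \<one>\<^bsub>?G\<^esub>"
    using b by (intro blinfun_eqI) (simp add: GL_def S bij_is_inj)
  ultimately show "\<exists>S\<in>carrier ?G. S \<otimes>\<^bsub>?G\<^esub> T = \<one>\<^bsub>?G\<^esub>"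
    by blast
qed (auto simp: GL_def intro!: blinfun_eqI)

definition weak_operator_topology ::
    "('a::real_normed_vector \<Rightarrow>\<^sub>L 'b::real_normed_vector) topology" where
  "weak_operator_topology = topology_generated_by
     {{T. blinfun_apply f (blinfun_apply T x) \<in> U} | (x :: 'a) (f :: 'b \<Rightarrow>\<^sub>L real) U. open U}"

definition light :: "('a::real_normed_vector \<Rightarrow>\<^sub>L 'a) set \<Rightarrow> bool" where
  "light G \<longleftrightarrow>
     subtopology weak_operator_topology G = subtopology strong_operator_topology G"

definition SOT_discrete :: "('a::real_normed_vector \<Rightarrow>\<^sub>L 'a) set \<Rightarrow> bool" where
  "SOT_discrete G \<longleftrightarrow> subtopology strong_operator_topology G = discrete_topology G"

text \<open>The infimum is taken in the extended reals, so that it is infinite for the trivial group.\<close>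

definition distinguished_point ::
    "('a::real_normed_vector \<Rightarrow>\<^sub>L 'a) set \<Rightarrow> 'a \<Rightarrow> bool" where
  "distinguished_point G x \<longleftrightarrow>
     (INF T\<in>G - {id_blinfun}. ereal (norm (blinfun_apply T x - x))) > 0"

end

theory Submission
  imports Defs
begin

text \<open>
  Let \<open>b\<^sub>0 = (cos \<surd>n)\<^sub>n\<close> and \<open>b\<^sub>1 = (sin \<surd>n)\<^sub>n\<close>. The finite sign changes of coordinates act
  isometrically on the subspace spanned by \<open>c\<^sub>0\<close>, \<open>b\<^sub>0\<close>, \<open>b\<^sub>1\<close> of the bounded sequences, and this
  subspace is isomorphic to \<open>c\<^sub>0\<close>. Changing the sign of coordinate \<open>n\<close> moves
  \<open>y + \<alpha> b\<^sub>0 + \<beta> b\<^sub>1\<close> by \<open>2 \<bar>y\<^sub>n + \<alpha> cos \<surd>n + \<beta> sin \<surd>n\<bar>\<close>. As the points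
  \<open>(cos \<surd>n, sin \<surd>n)\<close> are dense in the unit circle, this is arbitrarily small for suitable \<open>n\<close>,
  so no point is distinguished; but \<open>b\<^sub>0\<close> and \<open>b\<^sub>1\<close> together detect every sign change, because
  \<open>cos\<^sup>2 + sin\<^sup>2 = 1\<close>. The displacements are bounded multiples of the weakly null unit vectors,
  so the sign changes of single coordinates tend to the identity in the weak operator topology.
\<close>

section \<open>Unit vectors of \<open>c0\<close> and their weak convergence to zero\<close>

definition c0_unit :: "nat \<Rightarrow> c0" where
  "c0_unit k = Abs_c0 (\<lambda>n. if n = k then 1 else 0)"

lemma c0_nth_Abs: "x \<longlonglongrightarrow> 0 \<Longrightarrow> c0_nth (Abs_c0 x) = x"
  by (simp add: Abs_c0_inverse)

lemma c0_nth_unit [simp]: "c0_nth (c0_unit k) n = (if n = k then 1 else 0)"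
proof -
  have "(\<lambda>n. if n = k then 1 else 0 :: real) \<longlonglongrightarrow> 0"
    by (rule tendsto_eventually, rule eventually_sequentiallyI[of "Suc k"]) auto
  then show ?thesis
    by (simp add: c0_unit_def c0_nth_Abs)
qed

lemma c0_nth_sum: "c0_nth (\<Sum>i\<in>A. f i) n = (\<Sum>i\<in>A. c0_nth (f i) n)"
  by (induction A rule: infinite_finite_induct) auto

text \<open>This is the easy half of the duality between \<open>c0\<close> and the summable
  sequences: signed sums of distinct unit vectors have norm at most 1, so \<open>norm f\<close>
  bounds every partial sum of the absolute values of \<open>f (c0_unit n)\<close>.\<close>

lemma functional_unit_tendsto_0:
  fixes f :: "c0 \<Rightarrow>\<^sub>L real"
  shows "(\<lambda>n. f (c0_unit n)) \<longlonglongrightarrow> 0"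
proof -
  have "(\<Sum>n<N. \<bar>f (c0_unit n)\<bar>) \<le> norm f" for N
  proof -
    let ?s = "\<Sum>n<N. sgn (f (c0_unit n)) *\<^sub>R c0_unit n"
    have "norm ?s \<le> 1"
    proof (rule norm_c0_leI)
      fix k
      have "c0_nth ?s k = (\<Sum>n<N. if n = k then sgn (f (c0_unit n)) else 0)"
        unfolding c0_nth_sum by (rule sum.cong) auto
      also have "\<dots> = (if k < N then sgn (f (c0_unit k)) else 0)"
        by simp
      finally show "\<bar>c0_nth ?s k\<bar> \<le> 1"
        by (simp add: sgn_if)
    qed
    have "(\<Sum>n<N. \<bar>f (c0_unit n)\<bar>) = f ?s"
      by (simp add: blinfun.sum_right blinfun.scaleR_right abs_sgn mult.commute)
    also have "\<dots> \<le> norm f * norm ?s"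
      using norm_blinfun[of f ?s] by simp
    also have "\<dots> \<le> norm f"
      using \<open>norm ?s \<le> 1\<close> by (simp add: mult_left_le)
    finally show ?thesis .
  qed
  then have "summable (\<lambda>n. \<bar>f (c0_unit n)\<bar>)"
    by (intro summableI_nonneg_bounded[where x = "norm f"]) simp_all
  then show ?thesis
    by (rule tendsto_rabs_zero_cancel[OF summable_LIMSEQ_zero])
qed

section \<open>Sign changes as bounded operators on \<open>c0\<close>\<close>

text \<open>Coordinates 0 and 1 of an element of \<open>c\<^sub>0\<close> hold the coefficients \<open>\<alpha>\<close>, \<open>\<beta>\<close>, the others hold \<open>y\<close>.\<close>

definition wave :: "c0 \<Rightarrow> nat \<Rightarrow> real" where
  "wave x n = c0_nth x 0 * cos (sqrt (real n)) + c0_nth x 1 * sin (sqrt (real n))"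

text \<open>The element \<open>x\<close> encodes the sequence \<open>c0_nth x n + wave x n\<close>.
  Negating its term at \<open>n\<close> and subtracting the unchanged \<open>wave x n\<close> again
  leaves \<open>- c0_nth x n - 2 * wave x n\<close>.\<close>

definition flip_fun :: "nat set \<Rightarrow> c0 \<Rightarrow> c0" where
  "flip_fun A x = Abs_c0 (\<lambda>n. if n \<in> A then - c0_nth x n - 2 * wave x n else c0_nth x n)"

definition flip :: "nat set \<Rightarrow> c0 \<Rightarrow>\<^sub>L c0" where
  "flip A = Blinfun (flip_fun A)"

text \<open>Finiteness of \<open>A\<close> makes the new sequence agree with \<open>x\<close> from
  some index on, so it is still null and \<open>Abs_c0\<close> is applied inside its domain.\<close>

lemma c0_nth_flip_fun:
  assumes "finite A"
  shows "c0_nth (flip_fun A x) n = (if n \<in> A then - c0_nth x n - 2 * wave x n else c0_nth x n)"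
proof -
  obtain N where N: "\<And>n. n \<in> A \<Longrightarrow> n < N"
    using assms unfolding finite_nat_set_iff_bounded by blast
  have "(\<lambda>n. if n \<in> A then - c0_nth x n - 2 * wave x n else c0_nth x n) \<longlonglongrightarrow> 0"
    by (rule Lim_transform_eventually[OF c0_nth_tendsto[of x]],
        rule eventually_sequentiallyI[of N]) (auto dest: N)
  then show ?thesis
    by (simp add: flip_fun_def c0_nth_Abs)
qed

lemma abs_wave_le: "\<bar>wave x n\<bar> \<le> 2 * norm x"
proof -
  have "\<bar>wave x n\<bar> \<le> \<bar>c0_nth x 0\<bar> * \<bar>cos (sqrt n)\<bar> + \<bar>c0_nth x 1\<bar> * \<bar>sin (sqrt n)\<bar>"
    unfolding wave_def abs_mult[symmetric] by (rule abs_triangle_ineq)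
  also have "\<dots> \<le> \<bar>c0_nth x 0\<bar> + \<bar>c0_nth x 1\<bar>"
    by (intro add_mono mult_left_le) auto
  also have "\<dots> \<le> 2 * norm x"
    using abs_c0_nth_le_norm[of x 0] abs_c0_nth_le_norm[of x 1] by linarith
  finally show ?thesis .
qed

text \<open>The constant is 1 + 2 * 2, by \<open>abs_wave_le\<close>. It does not depend on
  \<open>A\<close>, which makes the group bounded.\<close>

lemma norm_flip_fun_le:
  assumes "finite A"
  shows "norm (flip_fun A x) \<le> norm x * 5"
proof (rule norm_c0_leI)
  fix n
  show "\<bar>c0_nth (flip_fun A x) n\<bar> \<le> norm x * 5"
    using abs_wave_le[of x n] abs_c0_nth_le_norm[of x n]
    unfolding c0_nth_flip_fun[OF assms] by (cases "n \<in> A"; simp only: if_True if_False; linarith)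
qed

lemma flip_apply:
  assumes "finite A"
  shows "blinfun_apply (flip A) = flip_fun A"
  unfolding flip_def
proof (rule bounded_linear_Blinfun_apply, rule bounded_linear_intro)
  show "norm (flip_fun A x) \<le> norm x * 5" for x
    by (rule norm_flip_fun_le[OF assms])
  show "flip_fun A (x + y) = flip_fun A x + flip_fun A y" for x y
  proof (rule c0_eqI)
    fix n
    show "c0_nth (flip_fun A (x + y)) n = c0_nth (flip_fun A x + flip_fun A y) n"
      by (cases "n \<in> A") (simp_all add: c0_nth_flip_fun assms wave_def ring_distribs)
  qed
  show "flip_fun A (r *\<^sub>R x) = r *\<^sub>R flip_fun A x" for r x
  proof (rule c0_eqI)
    fix n
    show "c0_nth (flip_fun A (r *\<^sub>R x)) n = c0_nth (r *\<^sub>R flip_fun A x) n"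
      by (cases "n \<in> A") (simp_all add: c0_nth_flip_fun assms wave_def ring_distribs)
  qed
qed

lemma c0_nth_flip:
  "finite A \<Longrightarrow> c0_nth (flip A x) n = (if n \<in> A then - c0_nth x n - 2 * wave x n else c0_nth x n)"
  by (simp add: flip_apply c0_nth_flip_fun)

lemma norm_flip_le: "finite A \<Longrightarrow> norm (flip A) \<le> 5"
  by (rule norm_blinfun_bound) (simp_all add: flip_apply norm_flip_fun_le mult.commute[of 5])

lemma flip_empty: "flip {} = id_blinfun"
  by (intro blinfun_eqI c0_eqI) (simp add: c0_nth_flip)

section \<open>The group of finite sign changes\<close>

definition flip_sets :: "nat set set" where
  "flip_sets = {A. finite A \<and> 0 \<notin> A \<and> 1 \<notin> A}"

text \<open>Coordinates 0 and 1 lie outside \<open>B\<close>, so \<open>flip B\<close> preserves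
  \<open>wave x\<close>; hence two flips at one index cancel. The group is therefore the finite sets
  under symmetric difference, and each element is its own inverse.\<close>

lemma flip_compose:
  assumes "A \<in> flip_sets" "B \<in> flip_sets"
  shows "flip A o\<^sub>L flip B = flip (sym_diff A B)"
proof (intro blinfun_eqI c0_eqI)
  fix x n
  have "wave (flip B x) n = wave x n"
    using assms by (simp add: wave_def c0_nth_flip flip_sets_def)
  then show "c0_nth ((flip A o\<^sub>L flip B) x) n = c0_nth (flip (sym_diff A B) x) n"
    using assms by (auto simp: c0_nth_flip flip_sets_def)
qed

lemma flip_involution: "A \<in> flip_sets \<Longrightarrow> flip A o\<^sub>L flip A = id_blinfun"
  by (simp add: flip_compose flip_empty)

lemma flip_in_GL:
  assumes "A \<in> flip_sets"
  shows "flip A \<in> carrier GL"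
proof -
  have inv: "flip A (flip A x) = x" for x
    using arg_cong[OF flip_involution[OF assms], of "\<lambda>T. blinfun_apply T x"] by simp
  then have "inv_into UNIV (blinfun_apply (flip A)) = blinfun_apply (flip A)"
    by (intro inv_equality) auto
  then show ?thesis
    using inv by (auto simp: GL_def blinfun.bounded_linear_right intro: involuntory_imp_bij)
qed

lemma subgroup_flip: "subgroup (flip ` flip_sets) GL"
proof (rule group.subgroupI[OF group_GL])
  show "flip ` flip_sets \<subseteq> carrier GL"
    using flip_in_GL by blast
  show "flip ` flip_sets \<noteq> {}"
    by (auto simp: flip_sets_def)
next
  fix T assume "T \<in> flip ` flip_sets"
  then obtain A where A: "A \<in> flip_sets" "T = flip A" by blast
  then have "inv\<^bsub>GL\<^esub> T = T"
    by (intro group.inv_equality[OF group_GL]) (auto simp: flip_in_GL, simp add: GL_def flip_involution)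
  then show "inv\<^bsub>GL\<^esub> T \<in> flip ` flip_sets"
    using A by simp
next
  fix S T assume "S \<in> flip ` flip_sets" "T \<in> flip ` flip_sets"
  then obtain A B where "A \<in> flip_sets" "S = flip A" "B \<in> flip_sets" "T = flip B" by blast
  moreover from this have "sym_diff A B \<in> flip_sets"
    by (auto simp: flip_sets_def)
  ultimately show "S \<otimes>\<^bsub>GL\<^esub> T \<in> flip ` flip_sets"
    by (simp add: GL_def flip_compose)
qed

section \<open>Uniform separation, injectivity and discreteness\<close>

lemma flip_separated:
  assumes "A \<in> flip_sets" "B \<in> flip_sets" "A \<noteq> B"
  shows "1 \<le> dist (flip A (c0_unit 0)) (flip B (c0_unit 0)) \<or>
         1 \<le> dist (flip A (c0_unit 1)) (flip B (c0_unit 1))"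
proof -
  obtain n where n: "n \<in> sym_diff A B"
    using assms by blast
  have "n \<noteq> 0" "n \<noteq> 1" "finite A" "finite B"
    using n assms by (auto simp: flip_sets_def)
  \<comment> \<open>Exactly one of the two operators flips index \<open>n\<close>; which one it is
    decides the sign.\<close>
  have diff: "c0_nth (flip A x - flip B x) n = 2 * (c0_nth x n + wave x n) \<or>
        c0_nth (flip A x - flip B x) n = - 2 * (c0_nth x n + wave x n)" for x
    using n \<open>finite A\<close> \<open>finite B\<close> by (auto simp: c0_nth_flip algebra_simps)
  have "\<bar>c0_nth (flip A x - flip B x) n\<bar> = 2 * \<bar>c0_nth x n + wave x n\<bar>" for x
    using diff[of x] by (auto simp only: abs_mult abs_neg_numeral abs_numeral)
  then have *: "2 * \<bar>c0_nth x n + wave x n\<bar> \<le> dist (flip A x) (flip B x)" for x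
    by (metis abs_c0_nth_le_norm dist_norm)
  let ?t = "sqrt (real n)"
  have "2 * \<bar>cos ?t\<bar> \<le> dist (flip A (c0_unit 0)) (flip B (c0_unit 0))"
       "2 * \<bar>sin ?t\<bar> \<le> dist (flip A (c0_unit 1)) (flip B (c0_unit 1))"
    using *[of "c0_unit 0"] *[of "c0_unit 1"] \<open>n \<noteq> 0\<close> \<open>n \<noteq> 1\<close> by (simp_all add: wave_def)
  \<comment> \<open>Otherwise the squares of cosine and sine would add up to less than 1/2.\<close>
  moreover have "1 \<le> 2 * \<bar>cos ?t\<bar> \<or> 1 \<le> 2 * \<bar>sin ?t\<bar>"
  proof (rule ccontr)
    assume "\<not> ?thesis"
    then have "\<bar>cos ?t\<bar>\<^sup>2 < (1/2)\<^sup>2" "\<bar>sin ?t\<bar>\<^sup>2 < (1/2)\<^sup>2"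
      by (intro power_strict_mono; simp)+
    then show False
      using sin_cos_squared_add[of ?t] by (simp add: power2_eq_square)
  qed
  ultimately show ?thesis by linarith
qed

lemma inj_on_flip: "inj_on flip flip_sets"
  by (rule inj_onI) (use flip_separated in fastforce)

lemma singleton_in_flip_sets: "n \<ge> 2 \<Longrightarrow> {n} \<in> flip_sets"
  by (auto simp: flip_sets_def)

lemma infinite_flip: "infinite (flip ` flip_sets)"
proof -
  have "(\<lambda>n. {n}) ` {2..} \<subseteq> flip_sets"
    using singleton_in_flip_sets by auto
  moreover have "infinite ((\<lambda>n::nat. {n}) ` {2..})"
    by (simp add: finite_image_iff infinite_Ici)
  ultimately show ?thesis
    using finite_subset by (auto simp: finite_image_iff[OF inj_on_flip])
qed

lemma flip_ne_id: "n \<ge> 2 \<Longrightarrow> flip {n} \<noteq> id_blinfun"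
  using inj_onD[OF inj_on_flip, of "{n}" "{}"] singleton_in_flip_sets
  by (auto simp: flip_empty flip_sets_def)

lemma SOT_discrete_flip: "SOT_discrete (flip ` flip_sets)"
proof -
  have "openin (subtopology strong_operator_topology (flip ` flip_sets)) {flip A}"
    if A: "A \<in> flip_sets" for A
  proof -
    \<comment> \<open>Radius 1 is the constant of \<open>flip_separated\<close>, so no other element
      of the group stays in both balls.\<close>
    let ?V = "{T. \<forall>i\<in>{0, 1}. blinfun_apply T (c0_unit i) \<in> ball (flip A (c0_unit i)) 1}"
    have "openin strong_operator_topology ?V"
      by (rule strong_operator_topology_basis) auto
    moreover have "{flip A} = ?V \<inter> flip ` flip_sets"
      using A flip_separated[OF A] by (fastforce simp: not_le[symmetric])
    ultimately show ?thesis
      unfolding openin_subtopology by blast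
  qed
  then show ?thesis
    unfolding SOT_discrete_def
    by (subst eq_commute, subst discrete_topology_unique) (auto simp: strong_operator_topology_topspace)
qed

section \<open>Convergence to the identity in the weak operator topology\<close>

lemma flip_singleton_diff:
  "flip {n} x - x = (- 2 * (c0_nth x n + wave x n)) *\<^sub>R c0_unit n"
  by (rule c0_eqI) (simp add: c0_nth_flip algebra_simps)

text \<open>The displacement is a multiple of \<open>c0_unit n\<close> with coefficient at most
  \<open>6 * norm x\<close> in absolute value, and \<open>f\<close> tends to 0 along the unit
  vectors.\<close>

lemma flip_singleton_WOT_tendsto:
  fixes f :: "c0 \<Rightarrow>\<^sub>L real"
  shows "(\<lambda>n. blinfun_apply f (flip {n} x)) \<longlonglongrightarrow> blinfun_apply f x"
proof -
  have "blinfun_apply f (flip {n} x) =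
      blinfun_apply f x + - 2 * (c0_nth x n + wave x n) * blinfun_apply f (c0_unit n)" for n
    using arg_cong[OF flip_singleton_diff[of n x], of "blinfun_apply f"]
    by (simp add: blinfun.diff_right blinfun.scaleR_right)
  moreover have "(\<lambda>n. - 2 * (c0_nth x n + wave x n) * blinfun_apply f (c0_unit n)) \<longlonglongrightarrow> 0"
  proof (rule Lim_null_comparison)
    show "(\<lambda>n. (2 * (3 * norm x)) * \<bar>blinfun_apply f (c0_unit n)\<bar>) \<longlonglongrightarrow> 0"
      by (intro tendsto_mult_right_zero tendsto_rabs_zero functional_unit_tendsto_0)
    have sum_le: "\<bar>c0_nth x n + wave x n\<bar> \<le> 3 * norm x" for n
      using abs_c0_nth_le_norm[of x n] abs_wave_le[of x n] by linarith
    have "\<bar>- 2 * (c0_nth x n + wave x n)\<bar> \<le> 2 * (3 * norm x)" for n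
      unfolding abs_mult abs_neg_numeral by (intro mult_left_mono sum_le) simp
    then show "\<forall>\<^sub>F n in sequentially. norm (- 2 * (c0_nth x n + wave x n) * blinfun_apply f (c0_unit n))
        \<le> (2 * (3 * norm x)) * \<bar>blinfun_apply f (c0_unit n)\<bar>"
      unfolding real_norm_def abs_mult[of _ "blinfun_apply f _"]
      by (intro always_eventually allI mult_right_mono) auto
  qed
  ultimately show ?thesis
    using tendsto_add[OF tendsto_const] by fastforce
qed

text \<open>Eventual membership passes to finite intersections and arbitrary unions, so induction
  over the generated topology reduces the claim to subbasic sets.\<close>

lemma eventually_flip_in_WOT_open:
  assumes "openin weak_operator_topology U" "id_blinfun \<in> U"
  shows "\<forall>\<^sub>F n in sequentially. flip {n} \<in> U"
proof -
  have "generate_topology_on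
      {{T. blinfun_apply f (blinfun_apply T x) \<in> V} | (x :: c0) (f :: c0 \<Rightarrow>\<^sub>L real) V. open V} U"
    using assms(1) unfolding weak_operator_topology_def openin_topology_generated_by_iff .
  then show ?thesis
    using assms(2)
  proof induction
    case (UN K)
    then obtain V where V: "V \<in> K" "id_blinfun \<in> V"
      by blast
    show ?case
      by (rule eventually_mono[OF UN.IH[OF V]]) (use V in blast)
  next
    case (Basis s)
    then obtain x and f :: "c0 \<Rightarrow>\<^sub>L real" and V where s: "s = {T. blinfun_apply f (blinfun_apply T x) \<in> V}" "open V"
      by blast
    then show ?case
      using topological_tendstoD[OF flip_singleton_WOT_tendsto[of f x] \<open>open V\<close>] Basis by simp
  qed (auto intro: eventually_conj)
qed

lemma not_light_flip: "\<not> light (flip ` flip_sets)"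
proof
  assume "light (flip ` flip_sets)"
  then have "openin (subtopology weak_operator_topology (flip ` flip_sets)) {id_blinfun}"
    using SOT_discrete_flip flip_empty unfolding light_def SOT_discrete_def
    by (force simp: flip_sets_def)
  then obtain U where U: "openin weak_operator_topology U" "{id_blinfun} = U \<inter> flip ` flip_sets"
    unfolding openin_subtopology by blast
  have "\<forall>\<^sub>F n in sequentially. flip {n} \<in> U"
    by (rule eventually_flip_in_WOT_open) (use U in auto)
  then have "\<forall>\<^sub>F n in sequentially. flip {n} \<in> U \<and> n \<ge> 2"
    using eventually_ge_at_top eventually_conj by blast
  then obtain n where "flip {n} \<in> U" "n \<ge> 2"
    using eventually_happens'[OF sequentially_bot] by blast
  then show False
    using U flip_ne_id singleton_in_flip_sets by blast
qed

section \<open>Square roots modulo the period, and the absence of distinguished points\<close>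

lemma sqrt_nat_floor_tendsto: "((\<lambda>t. sqrt (real (nat \<lfloor>t\<^sup>2\<rfloor>)) - t) \<longlongrightarrow> 0) at_top"
proof (rule Lim_null_comparison)
  show "((\<lambda>t::real. 1 / t) \<longlongrightarrow> 0) at_top"
    using tendsto_inverse_0_at_top[OF filterlim_ident] by (simp add: inverse_eq_divide)
  show "\<forall>\<^sub>F t in at_top. norm (sqrt (real (nat \<lfloor>t\<^sup>2\<rfloor>)) - t) \<le> 1 / t"
  proof (rule eventually_mono[OF eventually_gt_at_top[of 0]])
    fix t :: real assume t: "t > 0"
    define s where "s = sqrt (real (nat \<lfloor>t\<^sup>2\<rfloor>))"
    have "s \<ge> 0"
      by (simp add: s_def)
    have "s\<^sup>2 = of_int \<lfloor>t\<^sup>2\<rfloor>"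
      by (simp add: s_def)
    then have s: "s\<^sup>2 \<le> t\<^sup>2" "t\<^sup>2 - s\<^sup>2 \<le> 1"
      using of_int_floor_le[of "t\<^sup>2"] real_of_int_floor_add_one_ge[of "t\<^sup>2"] by linarith+
    have "s \<le> t"
      by (rule power2_le_imp_le[OF s(1)]) (use t in simp)
    \<comment> \<open>Since \<open>s\<close> is nonnegative, replacing \<open>t\<close> by
      \<open>t + s\<close> turns the gap into a difference of squares, which the floor keeps at most
      1.\<close>
    have "(t - s) * t \<le> (t - s) * (t + s)"
      by (rule mult_left_mono) (use \<open>s \<ge> 0\<close> \<open>s \<le> t\<close> in simp_all)
    also have "\<dots> = t\<^sup>2 - s\<^sup>2"
      by (simp add: power2_eq_square algebra_simps)
    also have "\<dots> \<le> 1"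
      by (rule s(2))
    finally have "t - s \<le> 1 / t"
      using t by (simp only: pos_le_divide_eq)
    then show "norm (s - t) \<le> 1 / t"
      using \<open>s \<le> t\<close> by simp
  qed
qed

text \<open>In polar form \<open>wave x n\<close> is a cosine sampled at \<open>sqrt n\<close>;
  these samples come arbitrarily close to its arbitrarily large zeros.\<close>

lemma wave_frequently_small:
  assumes "e > 0"
  shows "\<exists>n\<ge>N. \<bar>wave x n\<bar> < e"
proof -
  obtain r \<phi> where p: "c0_nth x 0 = r * cos \<phi>" "c0_nth x 1 = r * sin \<phi>"
    using polar_Ex by blast
  have w: "wave x n = r * cos (sqrt n - \<phi>)" for n
    by (simp only: wave_def p cos_diff) (simp add: algebra_simps)
  \<comment> \<open>The points \<open>t k\<close> are zeros of the cosine shifted by \<phi>, and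
    \<open>sqrt (m k)\<close> approximates \<open>t k\<close>.\<close>
  define t where "t k = \<phi> + pi / 2 + 2 * pi * real k" for k
  define m where "m k = nat \<lfloor>(t k)\<^sup>2\<rfloor>" for k
  have t: "filterlim t at_top sequentially"
    unfolding t_def
    by (intro filterlim_tendsto_add_at_top[OF tendsto_const]
        filterlim_tendsto_pos_mult_at_top[OF tendsto_const] filterlim_real_sequentially) simp
  have "(\<lambda>k. sqrt (m k) - t k) \<longlonglongrightarrow> 0"
    unfolding m_def by (rule filterlim_compose[OF sqrt_nat_floor_tendsto t])
  then have "(\<lambda>k. - r * sin (sqrt (m k) - t k)) \<longlonglongrightarrow> - r * sin 0"
    by (intro tendsto_intros)
  moreover have "- r * sin (sqrt (m k) - t k) = wave x (m k)" for k
  proof -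
    have "sqrt (m k) - \<phi> = (sqrt (m k) - t k) + pi / 2 + 2 * real k * pi"
      by (simp add: t_def)
    moreover have "cos (u + pi / 2 + 2 * real k * pi) = - sin u" for u
      unfolding cos_add[of _ "2 * real k * pi"] cos_2npi sin_2npi by (simp add: cos_add)
    ultimately have "cos (sqrt (m k) - \<phi>) = - sin (sqrt (m k) - t k)"
      by (rule trans[OF arg_cong])
    then show ?thesis by (simp add: w)
  qed
  ultimately have "(\<lambda>k. wave x (m k)) \<longlonglongrightarrow> 0"
    by simp
  then have "\<forall>\<^sub>F k in sequentially. \<bar>wave x (m k)\<bar> < e"
    using assms by (auto dest: order_tendstoD(2)[OF tendsto_rabs_zero])
  \<comment> \<open>The added 1 gives \<open>t k\<close> at least 1, so its square is at least
    \<open>t k\<close> and the floor \<open>m k\<close> reaches \<open>N\<close>.\<close>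
  moreover have "\<forall>\<^sub>F k in sequentially. t k \<ge> real N + 1"
    using t by (simp add: filterlim_at_top)
  ultimately have "\<forall>\<^sub>F k in sequentially. \<bar>wave x (m k)\<bar> < e \<and> t k \<ge> real N + 1"
    by (rule eventually_conj)
  then obtain k where k: "\<bar>wave x (m k)\<bar> < e" "t k \<ge> real N + 1"
    using eventually_happens'[OF sequentially_bot] by blast
  have "real N \<le> t k * 1"
    using k by simp
  also have "\<dots> \<le> (t k)\<^sup>2"
    unfolding power2_eq_square using k by (intro mult_left_mono) auto
  finally have "N \<le> m k"
    unfolding m_def by (simp add: le_nat_floor)
  with k show ?thesis by blast
qed

lemma no_distinguished_point_flip: "\<not> distinguished_point (flip ` flip_sets) x"
proof
  assume "distinguished_point (flip ` flip_sets) x"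
  then obtain c where c: "0 < ereal c"
      "ereal c < (INF T\<in>flip ` flip_sets - {id_blinfun}. ereal (norm (blinfun_apply T x - x)))"
    unfolding distinguished_point_def using ereal_dense2 by blast
  \<comment> \<open>Two terms below \<open>c / 4\<close>, doubled by the flip, keep the displacement
    within \<open>c\<close>.\<close>
  obtain N where N: "\<And>n. n \<ge> N \<Longrightarrow> \<bar>c0_nth x n\<bar> < c / 4"
    using LIMSEQ_D[OF c0_nth_tendsto[of x], of "c / 4"] c by auto
  obtain n where n: "n \<ge> max 2 N" "\<bar>wave x n\<bar> < c / 4"
    using wave_frequently_small[of "c / 4" "max 2 N" x] c(1) by auto
  have "flip {n} \<in> flip ` flip_sets - {id_blinfun}"
    using n flip_ne_id singleton_in_flip_sets by simp
  then have "ereal c < ereal (norm (flip {n} x - x))"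
    using c(2) by (meson INF_lower less_le_trans)
  moreover have "norm (flip {n} x - x) \<le> c"
  proof -
    have "norm (c0_unit n) \<le> 1"
      by (rule norm_c0_leI) simp
    have "norm (flip {n} x - x) = \<bar>- 2 * (c0_nth x n + wave x n)\<bar> * norm (c0_unit n)"
      unfolding flip_singleton_diff by simp
    also have "\<dots> \<le> \<bar>- 2 * (c0_nth x n + wave x n)\<bar>"
      using \<open>norm (c0_unit n) \<le> 1\<close> by (intro mult_left_le) auto
    also have "\<dots> \<le> c"
      using N[of n] n by simp
    finally show ?thesis .
  qed
  ultimately show False by simp
qed

theorem corollary6p3:
  shows "\<exists>G :: (c0 \<Rightarrow>\<^sub>L c0) set.
    subgroup G GL \<and> bounded G \<and> infinite G \<and> \<not> light G \<and> SOT_discrete G \<and>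
    \<not> (\<exists>x. distinguished_point G x)"
proof (intro exI conjI)
  show "bounded (flip ` flip_sets)"
    by (rule boundedI[of _ 5]) (auto simp: flip_sets_def norm_flip_le)
qed (use subgroup_flip infinite_flip not_light_flip SOT_discrete_flip
    no_distinguished_point_flip in auto)

end
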